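(* Let $N\ge3$, let $K\subset\mathbb{R}^N$ be the compact set defined in the context, and let $f(x)=|x|^2$ for $x\in K$. Let $0<\sigma<1$. Then there do not exist a constant $c>0$ and functions $v_\delta:K_\delta\to\mathbb{R}$, $0<\delta<\frac14\operatorname{diam}(K)$, such that for all such $\delta$: 1. $\Delta v_\delta(y)=0$ for $y\in K_\delta$; 2. $|v_\delta(x)-f(x)|\le c\,\delta^{2+\sigma}$ for $x\in K$; 3. $|v_\delta(y)-v_{\delta/2}(y)|\le c\,\delta^{2+\sigma}$ for $y\in K_{\delta/2}$. (That is, $f$ cannot be approximated on $K$ by harmonic functions, $\mathcal{L}=-\Delta$, with rate $\delta^{r}\omega(\delta)$ for $r=2$, $\omega(\delta)=\delta^\sigma$.)
   Context: $K_\delta=\{y\in\mathbb{R}^N:\operatorname{dist}(y,K)<\delta\}$. For $k=0,1,2,\dots$ put $$B^*_{k,1}=\{x\in\mathbb{R}^N:|x|\le2^{-k-2},\ x_{N-1}=x_N=0\},$$ $$B^*_{k,2}=\{x\in\mathbb{R}^N:|x|\le2^{-k-2},\ x_{N-2}=x_{N-1}=0\},$$ $$B^*_{k,3}=\{x\in\mathbb{R}^N:|x|\le2^{-k-2},\ x_{N-2}=x_{N}=0\},$$ $$B_{k,\iota}=B^*_{k,\iota}+\bigl(\tfrac12(2^{-k-1}+2^{-k}),0,\dots,0\bigr),\qquad \iota=1,2,3,$$ and $$K=\Bigl(\bigcup_{\iota=1}^{3}\bigcup_{k=0}^\infty B_{k,\iota}\Bigr)\cup\{0\}.$$ *)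

theory Defs
  imports "HOL-Analysis.Analysis"
begin

text \<open>
  Points of \<open>\<real>\<^sup>N\<close> are vectors \<open>x :: real ^ 'n\<close> with \<open>N = CARD('n)\<close>. A bijection
  \<open>e\<close> from \<open>{1..N}\<close> to the index type numbers the coordinates, so that
  \<open>x $ e j\<close> is the \<open>j\<close>-th coordinate of \<open>x\<close>.
\<close>

definition vanishing_coords :: "nat \<Rightarrow> nat \<Rightarrow> nat set" where
  "vanishing_coords N \<iota> =
     (if \<iota> = 1 then {N - 1, N}
      else if \<iota> = 2 then {N - 2, N - 1}
      else {N - 2, N})"

definition Bstar :: "(nat \<Rightarrow> 'n::finite) \<Rightarrow> nat \<Rightarrow> nat \<Rightarrow> (real ^ 'n) set" where
  "Bstar e k \<iota> =
     {x. norm x \<le> (1/2) ^ (k + 2) \<and> (\<forall>j \<in> vanishing_coords CARD('n) \<iota>. x $ e j = 0)}"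

definition Bset :: "(nat \<Rightarrow> 'n::finite) \<Rightarrow> nat \<Rightarrow> nat \<Rightarrow> (real ^ 'n) set" where
  "Bset e k \<iota> =
     (\<lambda>x. x + axis (e 1) (1/2 * ((1/2) ^ (k + 1) + (1/2) ^ k))) ` Bstar e k \<iota>"

definition Kset :: "(nat \<Rightarrow> 'n::finite) \<Rightarrow> (real ^ 'n) set" where
  "Kset e = (\<Union>\<iota> \<in> {1..3}. \<Union>k. Bset e k \<iota>) \<union> {0}"

definition nbhd :: "'a::metric_space set \<Rightarrow> real \<Rightarrow> 'a set" where
  "nbhd S \<delta> = {y. infdist y S < \<delta>}"

definition partial :: "'n::finite \<Rightarrow> (real ^ 'n \<Rightarrow> real) \<Rightarrow> real ^ 'n \<Rightarrow> real" where
  "partial i u x = deriv (\<lambda>t. u (x + axis i t)) 0"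

definition has_partials_on :: "(real ^ 'n::finite \<Rightarrow> real) \<Rightarrow> (real ^ 'n) set \<Rightarrow> bool" where
  "has_partials_on u U \<longleftrightarrow>
     (\<forall>i. \<forall>x \<in> U. (\<lambda>t. u (x + axis i t)) differentiable (at 0))"

text \<open>
  For open \<open>U\<close>. Functions are total, but only the values on \<open>U\<close> matter here and in
  the Laplacian at points of \<open>U\<close>. Differentiability is required explicitly
  because \<open>deriv\<close> has an unspecified value where no derivative exists.
\<close>

definition C2_on :: "(real ^ 'n::finite \<Rightarrow> real) \<Rightarrow> (real ^ 'n) set \<Rightarrow> bool" where
  "C2_on u U \<longleftrightarrow>
     continuous_on U u \<and> has_partials_on u U \<and>
     (\<forall>i. continuous_on U (partial i u) \<and> has_partials_on (partial i u) U \<and>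
       (\<forall>j. continuous_on U (partial j (partial i u))))"

definition laplacian :: "(real ^ 'n::finite \<Rightarrow> real) \<Rightarrow> real ^ 'n \<Rightarrow> real" where
  "laplacian u x = (\<Sum>i\<in>UNIV. partial i (partial i u) x)"

end

theory Submission
  imports Defs
begin

text \<open>
  Let \<open>z\<close> be the common centre of the three discs \<open>B\<^bsub>0,1\<^esub>, B\<^bsub>0,2\<^esub>, B\<^bsub>0,3\<^esub>\<close>. Every coordinate
  axis through \<open>z\<close> runs inside one of these discs near \<open>z\<close>, so the values of \<open>f\<close> on \<open>K\<close>
  determine all pure second derivatives of \<open>f\<close> at \<open>z\<close>. Each of them is \<open>2\<close>, and their sum is
  \<open>2 N \<noteq> 0\<close>. On the other hand, an approximation of order \<open>\<delta>\<^bsup>2+\<sigma>\<^esup>\<close> by harmonic functions on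
  \<open>\<delta>\<close>-neighbourhoods is good enough to pass to the limit in second derivatives: the difference
  of two successive approximants is harmonic and at most \<open>c \<delta>\<^bsup>2+\<sigma>\<^esup>\<close> on a ball of radius
  \<open>\<delta> / 2\<close>, so that interior estimates bound its second derivatives at \<open>z\<close> by a multiple of
  \<open>\<delta>\<^sup>\<sigma>\<close>, which is summable along \<open>\<delta>, \<delta> / 2, \<delta> / 4, \<dots>\<close>. Hence the pure second derivatives
  of \<open>f\<close> at \<open>z\<close> would be limits of those of harmonic functions and would have sum \<open>0\<close>.

  The argument is carried out with the symmetric second differences
  \<open>u (z + h e) + u (z - h e) - 2 u z\<close>, because interior estimates for these follow from the
  maximum principle alone. An odd difference \<open>u (a + h e) - u (a - h e)\<close> is bounded by \<open>O (h)\<close> by comparison with an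
  explicit quadratic polynomial (lemma \<open>harmonic_odd_difference_upper\<close>). As the odd difference is
  itself harmonic in \<open>a\<close>, applying the same bound twice gives \<open>O (h\<^sup>2)\<close> for the second difference
  (lemma \<open>harmonic_second_diff_bound\<close>). The limit argument is lemma
  \<open>second_derivs_of_approximable_sum_zero\<close>; there the step \<open>h\<close> is taken proportional to the
  current \<open>\<delta>\<close>, which makes the error \<open>O (\<delta>\<^bsup>2+\<sigma>\<^esup>)\<close> of approximation on \<open>K\<close> small compared
  with \<open>h\<^sup>2\<close>.
\<close>

section \<open>Second derivatives at a point of the line\<close>

text \<open>
  \<open>q\<close> is the second derivative of \<open>g\<close> at \<open>0\<close>. As a relation it asserts existence, which an
  equation for the iterated \<open>deriv\<close> would not, and it is visibly stable under linear combinations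
  and under \<open>t \<mapsto> - t\<close>.
\<close>

definition second_deriv :: "(real \<Rightarrow> real) \<Rightarrow> real \<Rightarrow> bool" where
  "second_deriv g q \<longleftrightarrow> (\<exists>p. (\<forall>\<^sub>F t in nhds 0. (g has_real_derivative p t) (at t)) \<and>
     (p has_real_derivative q) (at 0))"

lemma second_derivI:
  assumes "\<forall>\<^sub>F t in nhds 0. (g has_real_derivative p t) (at t)" "(p has_real_derivative q) (at 0)"
  shows "second_deriv g q"
  using assms unfolding second_deriv_def by (intro exI[of _ p]) auto

lemma second_deriv_diff:
  assumes "second_deriv f a" "second_deriv g b"
  shows "second_deriv (\<lambda>t. f t - g t) (a - b)"
proof -
  obtain p r where p: "\<forall>\<^sub>F t in nhds 0. (f has_real_derivative p t) (at t)" "(p has_real_derivative a) (at 0)"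
    and r: "\<forall>\<^sub>F t in nhds 0. (g has_real_derivative r t) (at t)" "(r has_real_derivative b) (at 0)"
    using assms unfolding second_deriv_def by blast
  have "\<forall>\<^sub>F t in nhds 0. ((\<lambda>t. f t - g t) has_real_derivative p t - r t) (at t)"
    using p(1) r(1) by eventually_elim (rule DERIV_diff)
  moreover have "((\<lambda>t. p t - r t) has_real_derivative a - b) (at 0)"
    using p(2) r(2) by (rule DERIV_diff)
  ultimately show ?thesis by (rule second_derivI)
qed

lemma second_deriv_cmult:
  assumes "second_deriv f a"
  shows "second_deriv (\<lambda>t. c * f t) (c * a)"
proof -
  obtain p where p: "\<forall>\<^sub>F t in nhds 0. (f has_real_derivative p t) (at t)" "(p has_real_derivative a) (at 0)"
    using assms unfolding second_deriv_def by blast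
  have "\<forall>\<^sub>F t in nhds 0. ((\<lambda>t. c * f t) has_real_derivative c * p t) (at t)"
    using p(1) by eventually_elim (rule DERIV_cmult)
  moreover have "((\<lambda>t. c * p t) has_real_derivative c * a) (at 0)"
    using p(2) by (rule DERIV_cmult)
  ultimately show ?thesis by (rule second_derivI)
qed

lemma eventually_nhds_0_minus:
  assumes "\<forall>\<^sub>F t in nhds (0::real). P t"
  shows "\<forall>\<^sub>F t in nhds (0::real). P (- t)"
  using assms by (rule eventually_compose_filterlim) (simp add: filterlim_def filtermap_nhds_minus)

lemma has_real_derivative_mirror:
  fixes g :: "real \<Rightarrow> real"
  assumes "(g has_real_derivative D) (at (- t))"
  shows "((\<lambda>h. g (- h)) has_real_derivative - D) (at t)"
  using assms by (simp add: DERIV_mirror)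

lemma second_deriv_mirror:
  assumes "second_deriv f a"
  shows "second_deriv (\<lambda>t. f (- t)) a"
proof -
  obtain p where p: "\<forall>\<^sub>F t in nhds 0. (f has_real_derivative p t) (at t)" "(p has_real_derivative a) (at 0)"
    using assms unfolding second_deriv_def by blast
  have "\<forall>\<^sub>F t in nhds 0. (f has_real_derivative p (- t)) (at (- t))"
    by (rule eventually_nhds_0_minus[OF p(1)])
  then have "\<forall>\<^sub>F t in nhds 0. ((\<lambda>t. f (- t)) has_real_derivative - p (- t)) (at t)"
    by eventually_elim (rule has_real_derivative_mirror)
  moreover have "((\<lambda>t. - p (- t)) has_real_derivative a) (at 0)"
    using DERIV_minus[OF has_real_derivative_mirror[of p a 0]] p(2) by simp
  ultimately show ?thesis by (rule second_derivI)
qed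

lemma second_deriv_quadratic: "second_deriv (\<lambda>t. \<alpha> + \<beta> * t + \<gamma> * t\<^sup>2) (2 * \<gamma>)"
  unfolding second_deriv_def
  by (intro exI[of _ "\<lambda>t. \<beta> + 2 * \<gamma> * t"] conjI always_eventually allI)
     (auto intro!: derivative_eq_intros)

text \<open>
  The first derivative is differentiable at \<open>0\<close>, but the second derivative may exist only there, so
  l'Hopital's rule can be applied just once. It reduces the claim to a symmetric difference
  quotient of the first derivative at \<open>0\<close>.
\<close>

lemma second_deriv_limit:
  assumes "second_deriv g q"
  shows "((\<lambda>h. (g h + g (- h) - 2 * g 0) / h\<^sup>2) \<longlongrightarrow> q) (at_right 0)"
proof -
  obtain p where p: "\<forall>\<^sub>F t in nhds 0. (g has_real_derivative p t) (at t)" "(p has_real_derivative q) (at 0)"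
    using assms unfolding second_deriv_def by blast
  have p': "\<forall>\<^sub>F t in nhds 0. (g has_real_derivative p (- t)) (at (- t))"
    by (rule eventually_nhds_0_minus[OF p(1)])
  have der: "\<forall>\<^sub>F t in at_right 0. ((\<lambda>h. g h + g (- h) - 2 * g 0) has_real_derivative p t - p (- t)) (at t)"
    unfolding eventually_at_filter using p(1) p'
  proof eventually_elim
    case (elim t)
    then show ?case
      using DERIV_diff[OF DERIV_add[OF elim(1) has_real_derivative_mirror[OF elim(2)]] DERIV_const[of "2 * g 0"]]
      by simp
  qed
  have g0: "isCont g 0"
    using eventually_nhds_x_imp_x[OF p(1)] DERIV_isCont by blast
  have num: "((\<lambda>h. g h + g (- h) - 2 * g 0) \<longlongrightarrow> 0) (at_right 0)"
  proof -
    have "isCont (\<lambda>h. g (- h)) 0"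
      using g0 by (intro isCont_o2[where f = uminus and g = g]) simp_all
    then have "isCont (\<lambda>h. g h + g (- h) - 2 * g 0) 0"
      using g0 by (intro isCont_diff isCont_add continuous_const)
    then have "((\<lambda>h. g h + g (- h) - 2 * g 0) \<longlongrightarrow> 0) (at 0)"
      by (simp add: isCont_def)
    then show ?thesis by (rule tendsto_mono[OF at_le[OF subset_UNIV]])
  qed
  have quot: "((\<lambda>h. (p h - p (- h)) / (2 * h)) \<longlongrightarrow> q) (at_right 0)"
  proof -
    have "((\<lambda>h. p h - p (- h)) has_real_derivative q + q) (at 0)"
      using DERIV_diff[OF p(2) has_real_derivative_mirror[of p q 0]] p(2) by simp
    then have "((\<lambda>h. (p h - p (- h)) / h) \<longlongrightarrow> q + q) (at 0)"
      by (simp add: has_field_derivative_iff)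
    then have "((\<lambda>h. (p h - p (- h)) / h / 2) \<longlongrightarrow> (q + q) / 2) (at 0)"
      by (intro tendsto_intros) auto
    then have "((\<lambda>h. (p h - p (- h)) / (2 * h)) \<longlongrightarrow> q) (at 0)"
      by (simp add: mult.commute)
    then show ?thesis by (rule tendsto_mono[OF at_le[OF subset_UNIV]])
  qed
  show ?thesis
  proof (rule lhopital_right_0[OF num _ _ _ der _ quot])
    show "((\<lambda>h::real. h\<^sup>2) \<longlongrightarrow> 0) (at_right 0)"
      by (auto intro!: tendsto_eq_intros)
    show "\<forall>\<^sub>F h in at_right 0. h\<^sup>2 \<noteq> (0::real)" "\<forall>\<^sub>F h in at_right 0. 2 * h \<noteq> (0::real)"
      by (auto simp: eventually_at_filter)
    show "\<forall>\<^sub>F h in at_right 0. ((\<lambda>h. h\<^sup>2) has_real_derivative 2 * h) (at (h::real))"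
      by (intro always_eventually allI) (auto intro!: derivative_eq_intros)
  qed
qed

lemma second_deriv_nonneg_at_local_min:
  assumes "second_deriv g q" and "\<forall>\<^sub>F t in nhds 0. g 0 \<le> g t"
  shows "0 \<le> q"
proof (rule tendsto_lowerbound[OF second_deriv_limit[OF assms(1)]])
  have "\<forall>\<^sub>F t in nhds 0. g 0 \<le> g (- t)"
    by (rule eventually_nhds_0_minus[OF assms(2)])
  then show "\<forall>\<^sub>F h in at_right 0. 0 \<le> (g h + g (- h) - 2 * g 0) / h\<^sup>2"
    unfolding eventually_at_filter using assms(2) by eventually_elim (intro impI divide_nonneg_nonneg, simp_all)
qed simp

section \<open>Harmonic functions and the minimum principle\<close>

lemma axis_add: "axis i (s + t) = axis i s + (axis i t :: real ^ 'n::finite)"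
  by (simp add: vec_eq_iff axis_def)

lemma axis_minus: "axis i (- t) = - (axis i t :: real ^ 'n::finite)"
  by (simp add: vec_eq_iff axis_def)

lemma axis_zero: "axis i 0 = (0 :: real ^ 'n::finite)"
  by (simp add: vec_eq_iff axis_def)

lemma axis_eq_scaleR: "axis i t = t *\<^sub>R (axis i 1 :: real ^ 'n::finite)"
  by (simp add: vec_eq_iff axis_def)

lemma norm_axis: "norm (axis i t :: real ^ 'n::finite) = \<bar>t\<bar>"
  by (subst axis_eq_scaleR) simp

text \<open>
  Stated through the pure second derivatives along the axes, because these are what the maximum
  principle inspects at an interior extremum. The sum condition is the Laplace equation.
\<close>

definition harmonic_on :: "(real ^ 'n::finite \<Rightarrow> real) \<Rightarrow> (real ^ 'n) set \<Rightarrow> bool" where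
  "harmonic_on u U \<longleftrightarrow> continuous_on U u \<and>
     (\<forall>x\<in>U. \<exists>q. (\<forall>i. second_deriv (\<lambda>t. u (x + axis i t)) (q i)) \<and> (\<Sum>i\<in>UNIV. q i) = 0)"

lemma tendsto_axis_line: "filterlim (\<lambda>t. x + axis i t) (nhds x) (nhds (0::real))"
  for x :: "real ^ 'n::finite"
proof -
  have "isCont (\<lambda>t. x + t *\<^sub>R axis i 1) 0"
    by (intro continuous_intros)
  then show ?thesis
    using tendsto_at_iff_tendsto_nhds[of "\<lambda>t. x + t *\<^sub>R axis i 1" 0]
    by (simp add: isCont_def axis_eq_scaleR[of i "_::real", symmetric] axis_zero)
qed

lemma harmonic_on_of_C2_laplacian:
  assumes "open U" "U \<subseteq> V" "C2_on u V" "\<And>y. y \<in> V \<Longrightarrow> laplacian u y = 0"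
  shows "harmonic_on u U"
proof -
  have der: "((\<lambda>s. w (x + axis i s)) has_real_derivative partial i w (x + axis i t)) (at t)"
    if "has_partials_on w V" "x + axis i t \<in> V" for w x i t
  proof -
    have "((\<lambda>s. w ((x + axis i t) + axis i s)) has_real_derivative partial i w (x + axis i t)) (at 0)"
      using that unfolding has_partials_on_def partial_def
      by (simp add: DERIV_deriv_iff_real_differentiable)
    then show ?thesis
      using DERIV_shift[of "\<lambda>s. w (x + axis i s)" _ 0 t]
      by (simp add: axis_add add_ac)
  qed
  have "second_deriv (\<lambda>t. u (x + axis i t)) (partial i (partial i u) x)" if x: "x \<in> U" for x i
    unfolding second_deriv_def
  proof (intro exI conjI)
    have "\<forall>\<^sub>F y in nhds x. y \<in> V"
      using assms(1,2) x by (auto simp: eventually_nhds)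
    then have "\<forall>\<^sub>F t in nhds 0. x + axis i t \<in> V"
      using tendsto_axis_line by (rule eventually_compose_filterlim)
    then show "\<forall>\<^sub>F t in nhds 0. ((\<lambda>s. u (x + axis i s)) has_real_derivative partial i u (x + axis i t)) (at t)"
      by (rule eventually_mono) (use assms(3) der in \<open>simp add: C2_on_def\<close>)
    show "((\<lambda>t. partial i u (x + axis i t)) has_real_derivative partial i (partial i u) x) (at 0)"
      using der[of "partial i u" x i 0] assms(2,3) x unfolding C2_on_def by (auto simp: axis_zero)
  qed
  moreover have "continuous_on U u"
    using assms(3) unfolding C2_on_def by (intro continuous_on_subset[OF _ assms(2)]) blast
  moreover have "(\<Sum>i\<in>UNIV. partial i (partial i u) x) = 0" if "x \<in> U" for x
    using assms(4)[of x] that assms(2) by (auto simp: laplacian_def)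
  ultimately show ?thesis
    unfolding harmonic_on_def by (auto intro!: exI[of _ "\<lambda>i. partial i (partial i u) _"])
qed

lemma harmonic_on_diff:
  assumes "harmonic_on u U" "harmonic_on w U"
  shows "harmonic_on (\<lambda>x. u x - w x) U"
  unfolding harmonic_on_def
proof (intro conjI ballI)
  show "continuous_on U (\<lambda>x. u x - w x)"
    using assms unfolding harmonic_on_def by (auto intro: continuous_intros)
  fix x assume "x \<in> U"
  then obtain q r where "\<forall>i. second_deriv (\<lambda>t. u (x + axis i t)) (q i)" "(\<Sum>i\<in>UNIV. q i) = 0"
    and "\<forall>i. second_deriv (\<lambda>t. w (x + axis i t)) (r i)" "(\<Sum>i\<in>UNIV. r i) = 0"
    using assms unfolding harmonic_on_def by meson
  then show "\<exists>q. (\<forall>i. second_deriv (\<lambda>t. u (x + axis i t) - w (x + axis i t)) (q i)) \<and> (\<Sum>i\<in>UNIV. q i) = 0"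
    by (intro exI[of _ "\<lambda>i. q i - r i"]) (auto intro: second_deriv_diff simp: sum_subtractf)
qed

lemma harmonic_on_cmult:
  assumes "harmonic_on u U"
  shows "harmonic_on (\<lambda>x. c * u x) U"
  unfolding harmonic_on_def
proof (intro conjI ballI)
  show "continuous_on U (\<lambda>x. c * u x)"
    using assms unfolding harmonic_on_def by (auto intro: continuous_intros)
  fix x assume "x \<in> U"
  then obtain q where "\<forall>i. second_deriv (\<lambda>t. u (x + axis i t)) (q i)" "(\<Sum>i\<in>UNIV. q i) = 0"
    using assms unfolding harmonic_on_def by meson
  then show "\<exists>q. (\<forall>i. second_deriv (\<lambda>t. c * u (x + axis i t)) (q i)) \<and> (\<Sum>i\<in>UNIV. q i) = 0"
    by (intro exI[of _ "\<lambda>i. c * q i"]) (auto intro: second_deriv_cmult simp: sum_distrib_left[symmetric])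
qed

lemma harmonic_on_translate:
  assumes "harmonic_on u U" "\<And>x. x \<in> V \<Longrightarrow> x + b \<in> U"
  shows "harmonic_on (\<lambda>x. u (x + b)) V"
  unfolding harmonic_on_def
proof (intro conjI ballI)
  have "continuous_on V (u \<circ> (\<lambda>x. x + b))"
    using assms unfolding harmonic_on_def
    by (intro continuous_on_compose continuous_intros) (auto intro: continuous_on_subset)
  then show "continuous_on V (\<lambda>x. u (x + b))" by (simp add: o_def)
  fix x assume "x \<in> V"
  then have "x + b \<in> U" by (rule assms(2))
  then obtain q where "\<forall>i. second_deriv (\<lambda>t. u ((x + b) + axis i t)) (q i)" "(\<Sum>i\<in>UNIV. q i) = 0"
    using assms(1) unfolding harmonic_on_def by meson
  then show "\<exists>q. (\<forall>i. second_deriv (\<lambda>t. u (x + axis i t + b)) (q i)) \<and> (\<Sum>i\<in>UNIV. q i) = 0"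
    by (auto simp: add_ac)
qed

definition reflect :: "'n::finite \<Rightarrow> real ^ 'n \<Rightarrow> real ^ 'n" where
  "reflect i x = x - axis i (2 * x $ i)"

lemma reflect_nth: "reflect i x $ j = (if j = i then - x $ j else x $ j)"
  by (auto simp: reflect_def axis_def)

text \<open>
  Along the reflected axis the function is run backwards, which leaves its second derivative
  unchanged; along the other axes nothing happens.
\<close>

lemma harmonic_on_reflect:
  assumes "harmonic_on u U" "\<And>x. x \<in> V \<Longrightarrow> reflect i x \<in> U"
  shows "harmonic_on (\<lambda>x. u (reflect i x)) V"
  unfolding harmonic_on_def
proof (intro conjI ballI)
  have "continuous_on V (reflect i)"
    unfolding reflect_def axis_eq_scaleR[of i "2 * _"]
    by (intro continuous_intros)
  then have "continuous_on V (u \<circ> reflect i)"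
    using assms unfolding harmonic_on_def
    by (intro continuous_on_compose) (auto intro: continuous_on_subset)
  then show "continuous_on V (\<lambda>x. u (reflect i x))" by (simp add: o_def)
  fix x assume "x \<in> V"
  then have "reflect i x \<in> U" by (rule assms(2))
  then obtain q where q: "\<forall>j. second_deriv (\<lambda>t. u (reflect i x + axis j t)) (q j)" "(\<Sum>i\<in>UNIV. q i) = 0"
    using assms(1) unfolding harmonic_on_def by meson
  have "second_deriv (\<lambda>t. u (reflect i (x + axis j t))) (q j)" for j
  proof (cases "j = i")
    case True
    have "reflect i (x + axis j t) = reflect i x + axis j (- t)" for t
      using True by (auto simp: vec_eq_iff reflect_nth axis_def)
    then show ?thesis using second_deriv_mirror[OF q(1)[rule_format, of j]] by simp
  next
    case False
    have "reflect i (x + axis j t) = reflect i x + axis j t" for t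
      using False by (auto simp: vec_eq_iff reflect_nth axis_def)
    then show ?thesis using q(1) by simp
  qed
  then show "\<exists>q. (\<forall>j. second_deriv (\<lambda>t. u (reflect i (x + axis j t))) (q j)) \<and> (\<Sum>i\<in>UNIV. q i) = 0"
    using q(2) by blast
qed

text \<open>
  A negative minimum would lie in the interior, where all pure second derivatives would be
  nonnegative, contrary to the strictly negative sum. The argument
  fails for a sum that is merely nonpositive; the barrier used below is therefore chosen strictly
  superharmonic.
\<close>

lemma minimum_principle:
  fixes G :: "real ^ 'n::finite \<Rightarrow> real"
  assumes "compact S" "continuous_on S G"
    and boundary: "\<And>x. x \<in> S - interior S \<Longrightarrow> 0 \<le> G x"
    and super: "\<And>x. x \<in> interior S \<Longrightarrow>
      \<exists>q. (\<forall>i. second_deriv (\<lambda>t. G (x + axis i t)) (q i)) \<and> (\<Sum>i\<in>UNIV. q i) < 0"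
    and "y \<in> S"
  shows "0 \<le> G y"
proof (rule ccontr)
  assume "\<not> 0 \<le> G y"
  obtain x where x: "x \<in> S" "\<And>z. z \<in> S \<Longrightarrow> G x \<le> G z"
    using continuous_attains_inf[OF assms(1) _ assms(2)] \<open>y \<in> S\<close> by blast
  with \<open>\<not> 0 \<le> G y\<close> \<open>y \<in> S\<close> boundary[of x] have int: "x \<in> interior S"
    by fastforce
  obtain q where q: "\<forall>i. second_deriv (\<lambda>t. G (x + axis i t)) (q i)" "(\<Sum>i\<in>UNIV. q i) < 0"
    using super[OF int] by blast
  have "0 \<le> q i" for i
  proof (rule second_deriv_nonneg_at_local_min[OF q(1)[rule_format, of i]])
    have "\<forall>\<^sub>F z in nhds x. z \<in> interior S"
      using int by (auto simp: eventually_nhds)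
    then have "\<forall>\<^sub>F t in nhds 0. x + axis i t \<in> interior S"
      using tendsto_axis_line by (rule eventually_compose_filterlim)
    then show "\<forall>\<^sub>F t in nhds 0. G (x + axis i 0) \<le> G (x + axis i t)"
      using x(2) interior_subset by (auto simp: axis_zero elim!: eventually_mono)
  qed
  then have "0 \<le> (\<Sum>i\<in>UNIV. q i)" by (simp add: sum_nonneg)
  with q(2) show False by simp
qed

section \<open>Interior estimates for differences of harmonic functions\<close>

lemma norm_add_axis_sq: "(norm (x + axis i t))\<^sup>2 = (norm x)\<^sup>2 + 2 * x $ i * t + t\<^sup>2"
  for x :: "real ^ 'n::finite"
  by (simp only: power2_norm_eq_inner)
     (simp add: inner_add_left inner_add_right inner_axis inner_axis' power2_eq_square distrib_right)

text \<open>
  A comparison argument in the half cube \<open>0 \<le> x\<^sub>i \<le> d, \<bar>x\<^sub>j\<bar> \<le> d\<close>. The odd part \<open>\<phi>\<close> of \<open>u\<close> with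
  respect to the hyperplane \<open>x\<^sub>i = 0\<close> is harmonic, vanishes on that face and is at most \<open>2 M\<close>
  on the others. The barrier \<open>\<psi>\<close> is a quadratic polynomial. Its term \<open>\<bar>x\<bar>\<^sup>2\<close> makes it at least
  \<open>2 M\<close> on the faces other than \<open>x\<^sub>i = 0\<close>; its term \<open>x\<^sub>i (d - x\<^sub>i)\<close> is nonnegative in the half
  cube, and the factor \<open>N + 1\<close> in front of it is large enough to make \<open>\<psi>\<close> strictly
  superharmonic, the \<open>N\<close> terms of \<open>\<Delta> \<bar>x\<bar>\<^sup>2 = 2 N\<close> being outweighed by \<open>- 2 (N + 1)\<close>. On the
  \<open>i\<close>-th axis \<open>\<psi>\<close> grows only linearly.
\<close>

lemma harmonic_odd_difference_upper:
  fixes u :: "real ^ 'n::finite \<Rightarrow> real"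
  assumes harm: "harmonic_on u U"
    and cube: "\<And>x. (\<And>j. \<bar>x $ j\<bar> \<le> d) \<Longrightarrow> a + x \<in> U \<and> \<bar>u (a + x)\<bar> \<le> M"
    and "0 < d" "0 < M" "0 \<le> h" "h \<le> d"
  shows "u (a + axis i h) - u (a - axis i h) \<le> 2 * (real CARD('n) + 1) * M * h / d"
proof -
  define N where "N = real CARD('n)"
  define S :: "(real ^ 'n) set" where "S = cbox (\<chi> j. if j = i then 0 else - d) (\<chi> j. d)"
  define C :: "(real ^ 'n) set" where "C = {x. \<forall>j. \<bar>x $ j\<bar> \<le> d}"
  define \<phi> where "\<phi> = (\<lambda>x. u (x + a) - u (reflect i x + a))"
  define \<psi> where "\<psi> = (\<lambda>x::real ^ 'n. 2 * M / d\<^sup>2 * ((norm x)\<^sup>2 + (N + 1) * x $ i * (d - x $ i)))"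
  have SC: "S \<subseteq> C"
  proof
    fix x assume "x \<in> S"
    then have "(if j = i then 0 else - d) \<le> x $ j \<and> x $ j \<le> d" for j
      by (auto simp: S_def mem_box_cart)
    then have "\<bar>x $ j\<bar> \<le> d" for j
      using \<open>0 < d\<close> by (smt (verit))
    then show "x \<in> C" by (simp add: C_def)
  qed
  have "harmonic_on (\<lambda>x. u (x + a)) C"
    by (rule harmonic_on_translate[OF harm]) (use cube in \<open>auto simp: C_def add.commute\<close>)
  moreover from this have "harmonic_on (\<lambda>x. u (reflect i x + a)) C"
    by (rule harmonic_on_reflect) (auto simp: C_def reflect_nth)
  ultimately have phi: "harmonic_on \<phi> C"
    unfolding \<phi>_def by (rule harmonic_on_diff)
  have phi_le: "\<phi> x \<le> 2 * M" if "x \<in> C" for x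
  proof -
    have "\<bar>x $ j\<bar> \<le> d" "\<bar>reflect i x $ j\<bar> \<le> d" for j
      using that by (auto simp: C_def reflect_nth)
    then have "\<bar>u (a + x)\<bar> \<le> M" "\<bar>u (a + reflect i x)\<bar> \<le> M"
      using cube by blast+
    then show ?thesis by (simp add: \<phi>_def add.commute)
  qed
  have "0 \<le> \<psi> y - \<phi> y" if "y \<in> S" for y
  proof (rule minimum_principle[OF _ _ _ _ that])
    show "compact S" by (simp add: S_def)
    show "continuous_on S (\<lambda>x. \<psi> x - \<phi> x)"
    proof (intro continuous_on_diff)
      show "continuous_on S \<psi>"
        unfolding \<psi>_def by (intro continuous_intros)
      show "continuous_on S \<phi>"
        using phi SC by (auto simp: harmonic_on_def intro: continuous_on_subset)
    qed
  next
    fix x assume x: "x \<in> S - interior S"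
    then have xC: "x \<in> C" and xi: "0 \<le> x $ i" "x $ i \<le> d"
      using SC by (auto simp: S_def mem_box_cart dest: spec[of _ i])
    then have pos: "0 \<le> (N + 1) * x $ i * (d - x $ i)"
      by (simp add: N_def)
    \<comment> \<open>Some coordinate sits on a face of the half cube.\<close>
    obtain j where j: "\<not> ((if j = i then 0 else - d) < x $ j \<and> x $ j < d)"
      using x by (auto simp: S_def interior_cbox mem_box_cart)
    show "0 \<le> \<psi> x - \<phi> x"
    proof (cases "x $ i = 0")
      case True
      then have "reflect i x = x" by (simp add: vec_eq_iff reflect_nth)
      then have "\<phi> x = 0" by (simp add: \<phi>_def)
      moreover have "0 \<le> \<psi> x"
        using pos \<open>0 < M\<close> by (simp add: \<psi>_def)
      ultimately show ?thesis by simp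
    next
      case False
      then have "d \<le> \<bar>x $ j\<bar>" using j xi by (auto split: if_splits)
      then have "d \<le> norm x" using component_le_norm_cart[of x j] by linarith
      then have "d\<^sup>2 \<le> (norm x)\<^sup>2" using \<open>0 < d\<close> by (intro power_mono) auto
      then have "2 * M / d\<^sup>2 * d\<^sup>2 \<le> \<psi> x"
        unfolding \<psi>_def using pos \<open>0 < M\<close> by (intro mult_left_mono) auto
      then show ?thesis using phi_le[OF xC] \<open>0 < d\<close> by simp
    qed
  next
    fix x assume "x \<in> interior S"
    then have "x \<in> C" using SC interior_subset by blast
    then obtain q where q: "\<forall>j. second_deriv (\<lambda>t. \<phi> (x + axis j t)) (q j)" "(\<Sum>j\<in>UNIV. q j) = 0"
      using phi unfolding harmonic_on_def by meson
    define r where "r = (\<lambda>j. 2 * M / d\<^sup>2 * (2 * (1 - (if j = i then N + 1 else 0))))"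
    have "second_deriv (\<lambda>t. \<psi> (x + axis j t)) (r j)" for j
    proof -
      have "(norm (x + axis j t))\<^sup>2 + (N + 1) * (x + axis j t) $ i * (d - (x + axis j t) $ i)
        = ((norm x)\<^sup>2 + (N + 1) * x $ i * (d - x $ i))
          + (2 * x $ j + (if j = i then (N + 1) * (d - 2 * x $ i) else 0)) * t
          + (1 - (if j = i then N + 1 else 0)) * t\<^sup>2" for t
        unfolding norm_add_axis_sq by (auto simp: axis_def algebra_simps power2_eq_square)
      then show ?thesis
        unfolding \<psi>_def r_def by (simp only: second_deriv_cmult second_deriv_quadratic)
    qed
    moreover have "(\<Sum>j\<in>UNIV. r j - q j) < 0"
    proof -
      have "(\<Sum>j\<in>UNIV. r j) = 2 * M / d\<^sup>2 * (2 * (\<Sum>j\<in>UNIV. 1 - (if j = i then N + 1 else 0)))"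
        unfolding r_def by (simp only: sum_distrib_left[symmetric])
      also have "(\<Sum>j\<in>UNIV. 1 - (if j = i then N + 1 else 0)) = - (1::real)"
        by (simp add: sum_subtractf N_def)
      finally have "(\<Sum>j\<in>UNIV. r j) = - (4 * M / d\<^sup>2)" by simp
      moreover have "0 < 4 * M / d\<^sup>2" using \<open>0 < M\<close> \<open>0 < d\<close> by simp
      ultimately show ?thesis using q(2) by (simp add: sum_subtractf)
    qed
    ultimately show "\<exists>q. (\<forall>j. second_deriv (\<lambda>t. \<psi> (x + axis j t) - \<phi> (x + axis j t)) (q j)) \<and> (\<Sum>j\<in>UNIV. q j) < 0"
      using q(1) by (intro exI[of _ "\<lambda>j. r j - q j"]) (auto intro: second_deriv_diff)
  qed
  moreover have "axis i h \<in> S"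
    using \<open>0 < d\<close> \<open>0 \<le> h\<close> \<open>h \<le> d\<close> by (auto simp: S_def mem_box_cart axis_def)
  ultimately have "\<phi> (axis i h) \<le> \<psi> (axis i h)" by fastforce
  also have "\<psi> (axis i h) \<le> 2 * M / d\<^sup>2 * ((N + 1) * h * d)"
  proof -
    have "h * h \<le> (N + 1) * (h * h)" using mult_right_mono[of 1 "N + 1" "h * h"] by (simp add: N_def)
    then have "(norm (axis i h :: real ^ 'n))\<^sup>2 + (N + 1) * h * (d - h) \<le> (N + 1) * h * d"
      by (simp add: norm_axis algebra_simps power2_eq_square)
    then show ?thesis
      unfolding \<psi>_def using \<open>0 < M\<close> by (intro mult_left_mono) auto
  qed
  also have "\<dots> = 2 * (N + 1) * M * h / d"
    using \<open>0 < d\<close> by (simp add: field_simps power2_eq_square)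
  also have "\<phi> (axis i h) = u (a + axis i h) - u (a - axis i h)"
  proof -
    have "reflect i (axis i h) = - axis i h"
      by (auto simp: vec_eq_iff reflect_nth axis_def)
    then show ?thesis by (simp add: \<phi>_def add.commute)
  qed
  finally show ?thesis by (simp add: N_def add.commute)
qed

lemma harmonic_odd_difference_bound:
  fixes u :: "real ^ 'n::finite \<Rightarrow> real"
  assumes harm: "harmonic_on u (ball z R)"
    and bound: "\<And>x. x \<in> ball z R \<Longrightarrow> \<bar>u x\<bar> \<le> M"
    and "dist z a + real CARD('n) * d < R"
    and "0 < d" "0 < M" "0 \<le> h" "h \<le> d"
  shows "\<bar>u (a + axis i h) - u (a - axis i h)\<bar> \<le> 2 * (real CARD('n) + 1) * M * h / d"
proof -
  have cube: "a + x \<in> ball z R" if "\<And>j. \<bar>x $ j\<bar> \<le> d" for x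
  proof -
    have "norm x \<le> (\<Sum>j\<in>UNIV. \<bar>x $ j\<bar>)" by (rule norm_le_l1_cart)
    also have "\<dots> \<le> real CARD('n) * d"
      using sum_bounded_above[of UNIV "\<lambda>j. \<bar>x $ j\<bar>" d] that by simp
    finally have "dist a (a + x) \<le> real CARD('n) * d" by (simp add: dist_norm)
    then show ?thesis
      using assms(3) dist_triangle[of z "a + x" a] by simp
  qed
  have "u (a + axis i h) - u (a - axis i h) \<le> 2 * (real CARD('n) + 1) * M * h / d"
    by (rule harmonic_odd_difference_upper[OF harm]) (use cube bound assms in auto)
  moreover have "(-1) * u (a + axis i h) - (-1) * u (a - axis i h) \<le> 2 * (real CARD('n) + 1) * M * h / d"
    by (rule harmonic_odd_difference_upper[OF harmonic_on_cmult[OF harm]]) (use cube bound assms in auto)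
  ultimately show ?thesis by linarith
qed

definition second_diff :: "(real ^ 'n::finite \<Rightarrow> real) \<Rightarrow> real ^ 'n \<Rightarrow> 'n \<Rightarrow> real \<Rightarrow> real" where
  "second_diff u x i h = u (x + axis i h) + u (x - axis i h) - 2 * u x"

text \<open>
  With \<open>k = h / 2\<close>, the second difference with step \<open>h\<close> is the odd difference with step \<open>k\<close> of the
  odd difference \<open>w\<close> with step \<open>k\<close>, and \<open>w\<close> is again harmonic. The first application of the odd
  difference bound gives \<open>w = O (k)\<close> on the ball of half the radius, the second one then gives
  \<open>O (k\<^sup>2)\<close> at the centre.
\<close>

lemma harmonic_second_diff_bound:
  fixes u :: "real ^ 'n::finite \<Rightarrow> real"
  assumes harm: "harmonic_on u (ball z R)"
    and bound: "\<And>x. x \<in> ball z R \<Longrightarrow> \<bar>u x\<bar> \<le> M"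
    and "0 < R" "0 < M" "0 < h" "h \<le> R / (2 * real CARD('n))"
  shows "\<bar>second_diff u z i h\<bar> \<le> 16 * (real CARD('n))\<^sup>2 * (real CARD('n) + 1)\<^sup>2 * M * h\<^sup>2 / R\<^sup>2"
proof -
  define N where "N = real CARD('n)"
  have "0 < N" by (simp add: N_def)
  \<comment> \<open>Cubes of half-width \<open>d\<close> reach at most \<open>N d = R / 4\<close> from their centres, so they stay in the
      full ball when centred in the half ball, and in the half ball when centred at \<open>z\<close>.\<close>
  define d where "d = R / (4 * N)"
  define k where "k = h / 2"
  define w where "w = (\<lambda>x. u (x + axis i k) - u (x + - axis i k))"
  define L where "L = 2 * (N + 1) * M * k / d"
  have d: "0 < d" "N * d = R / 4" using \<open>0 < R\<close> \<open>0 < N\<close> by (auto simp: d_def)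
  have k: "0 < k" "k \<le> d" using assms(5,6) \<open>0 < N\<close> by (auto simp: k_def d_def N_def field_simps)
  have "1 \<le> N" by (simp add: N_def)
  then have "d \<le> N * d" using d by simp
  then have kR: "k \<le> R / 4" using d k by linarith
  have "0 < L" using d k \<open>0 < M\<close> \<open>0 < N\<close> by (simp add: L_def)
  have shift: "x + b \<in> ball z R" if "x \<in> ball z (R / 2)" "norm b = k" for x b
    using that kR \<open>0 < R\<close> dist_triangle[of z "x + b" x] by (simp add: dist_norm)
  have hw: "harmonic_on w (ball z (R / 2))"
    unfolding w_def
    by (intro harmonic_on_diff harmonic_on_translate[OF harm] shift) (use k in \<open>auto simp: norm_axis\<close>)
  have bw: "\<bar>w x\<bar> \<le> L" if "x \<in> ball z (R / 2)" for x
    using harmonic_odd_difference_bound[OF harm bound, where a = x and d = d and h = k and i = i] that d k \<open>0 < M\<close> \<open>0 < R\<close>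
    by (simp add: w_def L_def N_def algebra_simps)
  have "\<bar>w (z + axis i k) - w (z - axis i k)\<bar> \<le> 2 * (real CARD('n) + 1) * L * k / d"
    by (rule harmonic_odd_difference_bound[OF hw bw]) (use d k \<open>0 < L\<close> \<open>0 < R\<close> in \<open>auto simp: N_def\<close>)
  moreover have "w (z + axis i k) - w (z - axis i k) = second_diff u z i h"
  proof -
    have "axis i h = axis i k + (axis i k :: real ^ 'n)"
      by (simp add: axis_add[symmetric] k_def)
    then show ?thesis by (simp add: w_def second_diff_def algebra_simps)
  qed
  moreover have "2 * (real CARD('n) + 1) * L * k / d = 16 * N\<^sup>2 * (N + 1)\<^sup>2 * M * h\<^sup>2 / R\<^sup>2"
    using \<open>0 < R\<close> \<open>0 < N\<close> by (simp add: L_def k_def d_def N_def[symmetric] field_simps power2_eq_square)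
  ultimately show ?thesis by (simp add: N_def)
qed

section \<open>Passing to the limit in harmonic approximations\<close>

lemma geometric_powr_sum_bound:
  fixes \<delta> \<sigma> :: real
  assumes "0 < \<delta>" "0 < \<sigma>"
  shows "(\<Sum>j<m. (\<delta> / 2 ^ j) powr \<sigma>) \<le> \<delta> powr \<sigma> / (1 - 2 powr (- \<sigma>))"
proof -
  define r where "r = 2 powr (- \<sigma>)"
  have r: "0 < r" "r < 1" using assms powr_less_cancel_iff[of 2 "- \<sigma>" 0] by (auto simp: r_def)
  have "(\<delta> / 2 ^ j) powr \<sigma> = \<delta> powr \<sigma> * r ^ j" for j
  proof -
    have "(2 ^ j) powr \<sigma> = (2 powr \<sigma>) ^ j"
      by (simp add: powr_realpow[symmetric] powr_powr powr_power mult.commute)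
    then show ?thesis
      using assms by (simp add: powr_divide r_def powr_minus power_inverse divide_inverse[symmetric] field_simps)
  qed
  then have "(\<Sum>j<m. (\<delta> / 2 ^ j) powr \<sigma>) = \<delta> powr \<sigma> * ((1 - r ^ m) / (1 - r))"
    using r by (simp add: sum_distrib_left[symmetric] sum_gp_strict)
  also have "\<dots> \<le> \<delta> powr \<sigma> * (1 / (1 - r))"
    using r by (intro mult_left_mono divide_right_mono) auto
  finally show ?thesis by (simp add: r_def)
qed

text \<open>
  Fix \<open>\<delta>\<close> and put \<open>\<epsilon>\<^sub>m = \<delta> / 2\<^sup>m\<close>, \<open>h\<^sub>m = \<epsilon>\<^sub>m / (4 N)\<close>. Telescoping the second difference bound from
  \<open>v\<^sub>\<delta>\<close> down to the approximant with index \<open>\<epsilon>\<^sub>m\<close> costs a multiple of \<open>\<delta>\<^sup>\<sigma> h\<^sub>m\<^sup>2\<close>, uniformly in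
  \<open>m\<close>; replacing that approximant by \<open>f\<close> costs \<open>O (\<epsilon>\<^sub>m\<^bsup>2+\<sigma>\<^esup>)\<close>, which is \<open>o (h\<^sub>m\<^sup>2)\<close>. After
  division by \<open>h\<^sub>m\<^sup>2\<close> and \<open>m \<rightarrow> \<infinity>\<close>, the second derivatives of \<open>f\<close> and of \<open>v\<^sub>\<delta>\<close> at \<open>z\<close> along an
  axis differ by at most a multiple of \<open>\<delta>\<^sup>\<sigma>\<close>. Those of \<open>v\<^sub>\<delta>\<close> have sum \<open>0\<close>, and \<open>\<delta>\<close> is arbitrarily
  small.
\<close>

lemma second_derivs_of_approximable_sum_zero:
  fixes K :: "(real ^ 'n::finite) set" and v :: "real \<Rightarrow> real ^ 'n \<Rightarrow> real"
  assumes "z \<in> K" "0 < D" "0 < c" "0 < \<sigma>"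
    and harm: "\<And>\<delta>. 0 < \<delta> \<Longrightarrow> \<delta> < D \<Longrightarrow> harmonic_on (v \<delta>) (ball z \<delta>)"
    and approx: "\<And>\<delta> x. 0 < \<delta> \<Longrightarrow> \<delta> < D \<Longrightarrow> x \<in> K \<Longrightarrow> \<bar>v \<delta> x - f x\<bar> \<le> c * \<delta> powr (2 + \<sigma>)"
    and cauchy: "\<And>\<delta> y. 0 < \<delta> \<Longrightarrow> \<delta> < D \<Longrightarrow> y \<in> ball z (\<delta> / 2) \<Longrightarrow>
                   \<bar>v \<delta> y - v (\<delta> / 2) y\<bar> \<le> c * \<delta> powr (2 + \<sigma>)"
    and cross: "\<And>i. \<forall>\<^sub>F h in at_right 0. z + axis i h \<in> K \<and> z - axis i h \<in> K"
    and lim: "\<And>i. ((\<lambda>h. second_diff f z i h / h\<^sup>2) \<longlongrightarrow> A i) (at_right 0)"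
  shows "(\<Sum>i\<in>UNIV. A i) = 0"
proof -
  define N where "N = real CARD('n)"
  have "1 \<le> N" by (simp add: N_def)
  \<comment> \<open>\<open>B\<close> is the constant of the second difference bound for \<open>M = c \<delta>\<^bsup>2+\<sigma>\<^esup>\<close> and \<open>R = \<delta> / 2\<close>;
      \<open>E\<close> also takes account of the geometric series over the halved values of \<open>\<delta>\<close>.\<close>
  define B where "B = 64 * N\<^sup>2 * (N + 1)\<^sup>2 * c"
  define E where "E = B / (1 - 2 powr (- \<sigma>))"
  have step: "\<bar>second_diff (v \<delta>) z i h - second_diff (v (\<delta> / 2)) z i h\<bar> \<le> B * \<delta> powr \<sigma> * h\<^sup>2"
    if "0 < \<delta>" "\<delta> < D" "0 < h" "h \<le> \<delta> / (4 * N)" for \<delta> h i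
  proof -
    have "harmonic_on (v \<delta>) (ball z (\<delta> / 2))"
    proof -
      have "ball z (\<delta> / 2) \<subseteq> ball z \<delta>" using that by (intro subset_ball) simp
      then show ?thesis
        using harm[OF that(1,2)] unfolding harmonic_on_def by (blast intro: continuous_on_subset)
    qed
    then have "harmonic_on (\<lambda>x. v \<delta> x - v (\<delta> / 2) x) (ball z (\<delta> / 2))"
      using that by (intro harmonic_on_diff harm) auto
    then have "\<bar>second_diff (\<lambda>x. v \<delta> x - v (\<delta> / 2) x) z i h\<bar>
      \<le> 16 * (real CARD('n))\<^sup>2 * (real CARD('n) + 1)\<^sup>2 * (c * \<delta> powr (2 + \<sigma>)) * h\<^sup>2 / (\<delta> / 2)\<^sup>2"
      by (rule harmonic_second_diff_bound) (use that cauchy \<open>0 < c\<close> in \<open>auto simp: N_def\<close>)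
    also have "\<dots> = B * \<delta> powr \<sigma> * h\<^sup>2"
      using that by (simp add: B_def N_def powr_add field_simps)
    finally show ?thesis by (simp add: second_diff_def algebra_simps)
  qed
  have close: "\<bar>\<Sum>i\<in>UNIV. A i\<bar> \<le> N * E * \<delta> powr \<sigma>" if \<delta>: "0 < \<delta>" "\<delta> < D" for \<delta>
  proof -
    define \<epsilon> where "\<epsilon> = (\<lambda>m::nat. \<delta> / 2 ^ m)"
    define h where "h = (\<lambda>m. \<epsilon> m / (4 * N))"
    have eps: "0 < \<epsilon> m" "\<epsilon> m \<le> \<delta>" "\<epsilon> m < D" "\<epsilon> (Suc m) = \<epsilon> m / 2" for m
    proof -
      show "0 < \<epsilon> m" using \<delta> by (simp add: \<epsilon>_def)
      show "\<epsilon> m \<le> \<delta>" using \<delta> by (simp add: \<epsilon>_def divide_le_eq)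
      then show "\<epsilon> m < D" using \<delta> by simp
      show "\<epsilon> (Suc m) = \<epsilon> m / 2" by (simp add: \<epsilon>_def)
    qed
    have "decseq \<epsilon>"
      using eps by (intro decseq_SucI) (simp add: eps(4) less_imp_le[OF eps(1)])
    have eps0: "\<epsilon> \<longlonglongrightarrow> 0"
    proof -
      have "(\<lambda>m. \<delta> * (1 / 2) ^ m) \<longlonglongrightarrow> 0"
        by (intro tendsto_mult_right_zero LIMSEQ_realpow_zero) auto
      then show ?thesis by (simp add: \<epsilon>_def power_divide)
    qed
    have hpos: "0 < h m" for m using eps \<open>1 \<le> N\<close> by (simp add: h_def)
    have h0: "h \<longlonglongrightarrow> 0"
      unfolding h_def using tendsto_divide[OF eps0 tendsto_const, of "4 * N"] \<open>1 \<le> N\<close> by simp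
    then have hr: "filterlim h (at_right 0) sequentially"
      using hpos by (auto simp: filterlim_at less_imp_neq[THEN not_sym])
    obtain q where q: "\<forall>i. second_deriv (\<lambda>t. v \<delta> (z + axis i t)) (q i)" "(\<Sum>i\<in>UNIV. q i) = 0"
      using harm[OF \<delta>] \<delta> unfolding harmonic_on_def by force
    have "\<bar>A i - q i\<bar> \<le> E * \<delta> powr \<sigma>" for i
    proof -
      have telescope: "\<bar>second_diff (v \<delta>) z i (h m) - second_diff (v (\<epsilon> m)) z i (h m)\<bar> \<le> E * \<delta> powr \<sigma> * (h m)\<^sup>2" for m
      proof -
        have "second_diff (v (\<epsilon> m)) z i (h m) - second_diff (v (\<epsilon> 0)) z i (h m) =
          (\<Sum>j<m. second_diff (v (\<epsilon> (Suc j))) z i (h m) - second_diff (v (\<epsilon> j)) z i (h m))"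
          by (rule sum_lessThan_telescope[symmetric])
        then have "\<bar>second_diff (v \<delta>) z i (h m) - second_diff (v (\<epsilon> m)) z i (h m)\<bar>
          = \<bar>\<Sum>j<m. second_diff (v (\<epsilon> (Suc j))) z i (h m) - second_diff (v (\<epsilon> j)) z i (h m)\<bar>"
          by (simp add: \<epsilon>_def abs_minus_commute)
        also have "\<dots> \<le> (\<Sum>j<m. \<bar>second_diff (v (\<epsilon> (Suc j))) z i (h m) - second_diff (v (\<epsilon> j)) z i (h m)\<bar>)"
          by (rule sum_abs)
        also have "\<dots> \<le> (\<Sum>j<m. B * \<epsilon> j powr \<sigma> * (h m)\<^sup>2)"
        proof (rule sum_mono)
          fix j assume "j \<in> {..<m}"
          then have "\<epsilon> m \<le> \<epsilon> j" using \<open>decseq \<epsilon>\<close> by (simp add: decseqD)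
          then have "h m \<le> \<epsilon> j / (4 * N)"
            unfolding h_def using \<open>1 \<le> N\<close> by (intro divide_right_mono) auto
          then show "\<bar>second_diff (v (\<epsilon> (Suc j))) z i (h m) - second_diff (v (\<epsilon> j)) z i (h m)\<bar> \<le> B * \<epsilon> j powr \<sigma> * (h m)\<^sup>2"
            using step[of "\<epsilon> j" "h m" i] eps(1,3)[of j] hpos[of m]
            unfolding eps(4) by (simp only: abs_minus_commute)
        qed
        also have "\<dots> = B * (\<Sum>j<m. \<epsilon> j powr \<sigma>) * (h m)\<^sup>2"
          by (simp add: sum_distrib_left sum_distrib_right)
        also have "\<dots> \<le> B * (\<delta> powr \<sigma> / (1 - 2 powr (- \<sigma>))) * (h m)\<^sup>2"
          using geometric_powr_sum_bound[OF \<delta>(1) \<open>0 < \<sigma>\<close>, of m] \<open>0 < c\<close>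
          by (intro mult_right_mono mult_left_mono) (auto simp: B_def \<epsilon>_def)
        finally show ?thesis by (simp add: E_def)
      qed
      have near: "\<forall>\<^sub>F m in sequentially. \<bar>second_diff (v (\<epsilon> m)) z i (h m) - second_diff f z i (h m)\<bar>
          \<le> 64 * N\<^sup>2 * c * \<epsilon> m powr \<sigma> * (h m)\<^sup>2"
        using eventually_compose_filterlim[OF cross[of i] hr]
      proof eventually_elim
        case (elim m)
        have "\<bar>second_diff (v (\<epsilon> m)) z i (h m) - second_diff f z i (h m)\<bar> \<le> 4 * (c * \<epsilon> m powr (2 + \<sigma>))"
          using approx[OF eps(1)[of m] eps(3)[of m], of "z + axis i (h m)"]
            approx[OF eps(1)[of m] eps(3)[of m], of "z - axis i (h m)"]
            approx[OF eps(1)[of m] eps(3)[of m], of z] elim \<open>z \<in> K\<close>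
          unfolding second_diff_def by linarith
        also have "\<dots> = 64 * N\<^sup>2 * c * \<epsilon> m powr \<sigma> * (h m)\<^sup>2"
          using eps(1)[of m] \<open>1 \<le> N\<close> by (simp add: h_def powr_add field_simps)
        finally show ?case .
      qed
      have "\<forall>\<^sub>F m in sequentially. \<bar>second_diff f z i (h m) / (h m)\<^sup>2 - second_diff (v \<delta>) z i (h m) / (h m)\<^sup>2\<bar>
          \<le> E * \<delta> powr \<sigma> + 64 * N\<^sup>2 * c * \<epsilon> m powr \<sigma>"
        using near
      proof eventually_elim
        case (elim m)
        with telescope[of m]
        have "\<bar>second_diff f z i (h m) - second_diff (v \<delta>) z i (h m)\<bar>
          \<le> (E * \<delta> powr \<sigma> + 64 * N\<^sup>2 * c * \<epsilon> m powr \<sigma>) * (h m)\<^sup>2"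
          unfolding distrib_right by linarith
        then have "\<bar>second_diff f z i (h m) - second_diff (v \<delta>) z i (h m)\<bar> / (h m)\<^sup>2
          \<le> E * \<delta> powr \<sigma> + 64 * N\<^sup>2 * c * \<epsilon> m powr \<sigma>"
          using hpos[of m] by (simp add: divide_le_eq)
        then show ?case by (simp add: diff_divide_distrib[symmetric] abs_divide)
      qed
      moreover have "(\<lambda>m. E * \<delta> powr \<sigma> + 64 * N\<^sup>2 * c * \<epsilon> m powr \<sigma>) \<longlonglongrightarrow> E * \<delta> powr \<sigma> + 64 * N\<^sup>2 * c * 0"
      proof -
        have "(\<lambda>m. \<epsilon> m powr \<sigma>) \<longlonglongrightarrow> 0 powr \<sigma>"
          using eps0 \<open>0 < \<sigma>\<close> eps(1) by (intro tendsto_powr' tendsto_const) (auto simp: less_imp_le[OF eps(1)])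
        then show ?thesis by (intro tendsto_intros) simp
      qed
      moreover have "(\<lambda>m. \<bar>second_diff f z i (h m) / (h m)\<^sup>2 - second_diff (v \<delta>) z i (h m) / (h m)\<^sup>2\<bar>) \<longlonglongrightarrow> \<bar>A i - q i\<bar>"
      proof -
        have "((\<lambda>h. second_diff (v \<delta>) z i h / h\<^sup>2) \<longlongrightarrow> q i) (at_right 0)"
          using second_deriv_limit[OF q(1)[rule_format, of i]] by (simp add: second_diff_def axis_minus axis_zero)
        then show ?thesis
          by (intro tendsto_intros filterlim_compose[OF lim hr] filterlim_compose[OF _ hr])
      qed
      ultimately have "\<bar>A i - q i\<bar> \<le> E * \<delta> powr \<sigma> + 64 * N\<^sup>2 * c * 0"
        by (intro tendsto_le[OF sequentially_bot])
      then show ?thesis by simp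
    qed
    then have "\<bar>\<Sum>i\<in>UNIV. A i - q i\<bar> \<le> (\<Sum>i\<in>(UNIV::'n set). E * \<delta> powr \<sigma>)"
      by (intro order_trans[OF sum_abs] sum_mono)
    then show ?thesis using q(2) by (simp add: sum_subtractf N_def mult.assoc)
  qed
  have "((\<lambda>\<delta>. N * E * \<delta> powr \<sigma>) \<longlongrightarrow> N * E * 0 powr \<sigma>) (at_right 0)"
    using \<open>0 < \<sigma>\<close>
    by (intro tendsto_mult tendsto_const tendsto_powr' tendsto_ident_at)
       (auto simp: eventually_at_filter)
  moreover have "\<forall>\<^sub>F \<delta> in at_right 0. \<bar>\<Sum>i\<in>UNIV. A i\<bar> \<le> N * E * \<delta> powr \<sigma>"
    using eventually_at_right_less eventually_at_right_real[OF \<open>0 < D\<close>]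
    by (auto elim!: eventually_mono intro: close)
  ultimately have "\<bar>\<Sum>i\<in>UNIV. A i\<bar> \<le> N * E * 0 powr \<sigma>"
    by (rule tendsto_lowerbound) simp
  then show ?thesis by simp
qed

section \<open>The set and the theorem\<close>

text \<open>
  Each pair of coordinates vanishing on one of the three discs is taken from the last three
  coordinates, and every single coordinate is missing from at least one of the pairs. The common
  centre of the discs with \<open>k = 0\<close> is at \<open>(1/2) (1/2 + 1) = 3/4\<close>, and their radius is \<open>1/4\<close>.
\<close>

lemma cross_in_Kset:
  fixes e :: "nat \<Rightarrow> 'n::finite"
  assumes "CARD('n) \<ge> 3" "bij_betw e {1..CARD('n)} (UNIV :: 'n set)" "\<bar>h\<bar> \<le> 1 / 4"
  shows "axis (e 1) (3 / 4) + axis i h \<in> Kset e"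
proof -
  obtain j where j: "j \<in> {1..CARD('n)}" "e j = i"
    using assms(2) by (metis UNIV_I bij_betw_iff_bijections)
  obtain \<iota> where \<iota>: "\<iota> \<in> {1..3::nat}" "j \<notin> vanishing_coords CARD('n) \<iota>"
  proof (cases "j = CARD('n)")
    case True
    then show ?thesis by (intro that[of 2]) (use assms(1) in \<open>auto simp: vanishing_coords_def\<close>)
  next
    case False
    then show ?thesis
      using that[of 1] that[of 3] assms(1)
      by (cases "j = CARD('n) - 1") (auto simp: vanishing_coords_def)
  qed
  have "axis i h $ e l = 0" if "l \<in> vanishing_coords CARD('n) \<iota>" for l
  proof -
    have "l \<in> {1..CARD('n)}"
      using that assms(1) by (auto simp: vanishing_coords_def split: if_splits)
    then have "e l \<noteq> i"
      using j \<iota>(2) that assms(2) by (metis bij_betw_imp_inj_on inj_onD)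
    then show ?thesis by (simp add: axis_def)
  qed
  then have "axis i h \<in> Bstar e 0 \<iota>"
    using assms(3) by (simp add: Bstar_def power2_eq_square norm_axis)
  then have "axis (e 1) (3 / 4) + axis i h \<in> Bset e 0 \<iota>"
    unfolding Bset_def by (rule rev_image_eqI) (simp add: add.commute)
  then show ?thesis unfolding Kset_def using \<iota>(1) by blast
qed

lemma bounded_Kset: "bounded (Kset (e :: nat \<Rightarrow> 'n::finite))"
proof (rule boundedI)
  fix x assume "x \<in> Kset e"
  then consider "x = 0" | k \<iota> where "x \<in> Bset e k \<iota>" by (auto simp: Kset_def)
  then show "norm x \<le> 1"
  proof cases
    case 2
    then obtain y where y: "norm y \<le> (1 / 2) ^ (k + 2)"
      "x = y + axis (e 1) (1 / 2 * ((1 / 2) ^ (k + 1) + (1 / 2) ^ k))"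
      by (auto simp: Bset_def Bstar_def)
    have "norm x \<le> (1 / 2) ^ (k + 2) + 1 / 2 * ((1 / 2) ^ (k + 1) + (1 / 2) ^ k)"
      unfolding y(2) by (rule order_trans[OF norm_triangle_ineq]) (use y(1) in \<open>simp add: norm_axis\<close>)
    also have "\<dots> = (1 / 2) ^ k" by simp
    also have "\<dots> \<le> 1" by (simp add: power_le_one)
    finally show ?thesis .
  qed simp
qed

theorem theorem6p1:
  fixes e :: "nat \<Rightarrow> 'n::finite"
    and K :: "(real ^ 'n) set"
    and f :: "real ^ 'n \<Rightarrow> real"
    and \<sigma> :: real
  assumes "CARD('n) \<ge> 3"
    and "bij_betw e {1..CARD('n)} (UNIV :: 'n set)"
    and "K = Kset e"
    and "\<And>x. x \<in> K \<Longrightarrow> f x = (norm x)\<^sup>2"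
    and "0 < \<sigma>" and "\<sigma> < 1"
  shows "\<not> (\<exists>(c::real) (v :: real \<Rightarrow> real ^ 'n \<Rightarrow> real). c > 0 \<and>
           (\<forall>\<delta>. 0 < \<delta> \<and> \<delta> < diameter K / 4 \<longrightarrow>
              C2_on (v \<delta>) (nbhd K \<delta>) \<and>
              (\<forall>y \<in> nbhd K \<delta>. laplacian (v \<delta>) y = 0) \<and>
              (\<forall>x \<in> K. \<bar>v \<delta> x - f x\<bar> \<le> c * \<delta> powr (2 + \<sigma>)) \<and>
              (\<forall>y \<in> nbhd K (\<delta> / 2). \<bar>v \<delta> y - v (\<delta> / 2) y\<bar> \<le> c * \<delta> powr (2 + \<sigma>))))"
proof
  assume "\<exists>(c::real) (v :: real \<Rightarrow> real ^ 'n \<Rightarrow> real). c > 0 \<and>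
           (\<forall>\<delta>. 0 < \<delta> \<and> \<delta> < diameter K / 4 \<longrightarrow>
              C2_on (v \<delta>) (nbhd K \<delta>) \<and>
              (\<forall>y \<in> nbhd K \<delta>. laplacian (v \<delta>) y = 0) \<and>
              (\<forall>x \<in> K. \<bar>v \<delta> x - f x\<bar> \<le> c * \<delta> powr (2 + \<sigma>)) \<and>
              (\<forall>y \<in> nbhd K (\<delta> / 2). \<bar>v \<delta> y - v (\<delta> / 2) y\<bar> \<le> c * \<delta> powr (2 + \<sigma>)))"
  then obtain c v where "c > 0" and v: "\<And>\<delta>. 0 < \<delta> \<Longrightarrow> \<delta> < diameter K / 4 \<Longrightarrow>
              C2_on (v \<delta>) (nbhd K \<delta>) \<and>
              (\<forall>y \<in> nbhd K \<delta>. laplacian (v \<delta>) y = 0) \<and>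
              (\<forall>x \<in> K. \<bar>v \<delta> x - f x\<bar> \<le> c * \<delta> powr (2 + \<sigma>)) \<and>
              (\<forall>y \<in> nbhd K (\<delta> / 2). \<bar>v \<delta> y - v (\<delta> / 2) y\<bar> \<le> c * \<delta> powr (2 + \<sigma>))"
    by blast
  define z :: "real ^ 'n" where "z = axis (e 1) (3 / 4)"
  have cross: "z + axis i h \<in> K" if "\<bar>h\<bar> \<le> 1 / 4" for i h
    unfolding z_def assms(3) by (rule cross_in_Kset[OF assms(1,2) that])
  have "z \<in> K" using cross[of 0] by (simp add: axis_zero)
  have crossing: "z + axis i h \<in> K \<and> z - axis i h \<in> K" if "\<bar>h\<bar> \<le> 1 / 4" for i h
    using cross[of h i] cross[of "- h" i] that by (simp add: axis_minus)
  have "dist z (z + axis (e 1) (1 / 4)) \<le> diameter K"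
    using \<open>z \<in> K\<close> cross[of "1 / 4"] bounded_Kset[of e]
    by (intro diameter_bounded_bound) (auto simp: assms(3))
  then have D: "0 < diameter K / 4" by (simp add: dist_norm norm_axis)
  have ball: "ball z \<delta> \<subseteq> nbhd K \<delta>" for \<delta>
    using infdist_le[OF \<open>z \<in> K\<close>] by (force simp: nbhd_def dist_commute intro: le_less_trans)
  have small: "\<forall>\<^sub>F h in at_right 0. \<bar>h\<bar> \<le> (1 / 4 :: real)"
    using eventually_at_right_real[of 0 "1 / 4 :: real"] by (auto elim!: eventually_mono)
  have "(\<Sum>i\<in>(UNIV :: 'n set). 2) = (0::real)"
  proof (rule second_derivs_of_approximable_sum_zero[OF \<open>z \<in> K\<close> D \<open>c > 0\<close> \<open>0 < \<sigma>\<close>, of v f])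
    fix \<delta> assume \<delta>: "0 < \<delta>" "\<delta> < diameter K / 4"
    show "harmonic_on (v \<delta>) (ball z \<delta>)"
      using v[OF \<delta>] ball by (intro harmonic_on_of_C2_laplacian[of _ "nbhd K \<delta>"]) auto
    show "\<bar>v \<delta> x - f x\<bar> \<le> c * \<delta> powr (2 + \<sigma>)" if "x \<in> K" for x
      using v[OF \<delta>] that by blast
    show "\<bar>v \<delta> y - v (\<delta> / 2) y\<bar> \<le> c * \<delta> powr (2 + \<sigma>)" if "y \<in> ball z (\<delta> / 2)" for y
      using v[OF \<delta>] that ball by blast
  next
    fix i
    show "\<forall>\<^sub>F h in at_right 0. z + axis i h \<in> K \<and> z - axis i h \<in> K"
      using small by eventually_elim (rule crossing)
    have "\<forall>\<^sub>F h in at_right 0. second_diff f z i h / h\<^sup>2 = 2"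
      using small eventually_at_right_less[of "0::real"]
    proof eventually_elim
      case (elim h)
      have "f (z - axis i h) = (norm (z + axis i (- h)))\<^sup>2"
        using crossing[OF elim(1), of i] by (simp add: assms(4) axis_minus)
      then have "second_diff f z i h = 2 * h\<^sup>2"
        using crossing[OF elim(1), of i] \<open>z \<in> K\<close>
        by (simp add: second_diff_def assms(4) norm_add_axis_sq)
      then show ?case using elim(2) by simp
    qed
    then show "((\<lambda>h. second_diff f z i h / h\<^sup>2) \<longlongrightarrow> 2) (at_right 0)"
      by (rule tendsto_eventually)
  qed
  then show False by simp
qed

end
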